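(* Let $\mathcal{L}$ be a set-theoretic (respectively graph-theoretic) halo of groups and let $\mathcal{C}$ be a class of groups. Suppose that for every finite set (respectively finite graph) $Y$, $L(Y)$ lies in $\mathcal{C}$. Let $X$ be a set (respectively graph) and suppose $\Gamma\curvearrowright_{\alpha}X$ is a LEF action. Then the induced action $\hat{\alpha}:\Gamma\to\operatorname{Aut}(L(X))$ is a $\mathcal{C}$-LEF action.
   Context: Haloes. A halo of groups over a set $X$ is a family of groups $\{L(Y):Y\subseteq X\}$ such that (i) $L(Z)\leq L(Y)$ for all $Z\subseteq Y\subseteq X$; (ii) $L(\emptyset)$ is trivial and $L(X)=\langle L(Y):Y\subseteq X\text{ finite}\rangle$; (iii) $L(Y\cap Z)=L(Y)\cap L(Z)$ for all $Y,Z\subseteq X$. For a graph $X$, subsets of the vertex set are identified with induced subgraphs of $X$. A set-theoretic (respectively graph-theoretic) halo of groups is a covariant functor $\mathcal{L}$, written $X\mapsto L(X)$ on objects and $\pi\mapsto\hat\pi$ on morphisms, from the category of sets with injective functions (respectively graphs with inclusions of induced subgraphs, i.e. injective vertex maps preserving both adjacency and non-adjacency) to the category of groups with monomorphisms, such that for every set (graph) $X$ the family $\{\hat{\iota}(L(Y)):Y\subseteq X\}$ is a halo of groups over $X$, where $\iota:Y\hookrightarrow X$ is the inclusion. A group action $\Gamma\curvearrowright_\alpha X$ (by permutations, respectively graph automorphisms) induces the action $\hat\alpha:\Gamma\to\operatorname{Aut}(L(X))$, $\hat\alpha(g)=\widehat{\alpha(g)}$. LEF actions on sets and graphs. An action $\Gamma\curvearrowright_\alpha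 X$ on a set is a LEF action if for all finite $F\subseteq\Gamma$ and $Z\subseteq X$ there exist a finite group $Q$, a finite set $Y$, an action $Q\curvearrowright_\beta Y$ and functions $\rho:\Gamma\to Q$, $\pi:Z\to Y$, with $\pi$ injective, such that (i) for all $g,h\in F$ with $gh\in F$, $\rho(gh)=\rho(g)\rho(h)$; (ii) if $g\in F$ and $x\in Z$ are such that $\alpha(g)\cdot x\in Z$, then $\pi(\alpha(g)\cdot x)=\beta(\rho(g))\cdot\pi(x)$. For an action by automorphisms on a graph $X$, the definition is the same with $Z$ a finite induced subgraph of $X$, $Y$ a finite graph, $\beta$ an action by graph automorphisms, and $\pi$ an inclusion of an induced subgraph. LEF actions on groups. A partial homomorphism from a subset $A$ of a group to a group $K$ is a function $\phi$ with $\phi(gh)=\phi(g)\phi(h)$ whenever $g,h,gh\in A$. An action $\Gamma\curvearrowright_\beta\Delta$ by automorphisms is $\mathcal{C}$-LEF if for all finite $F\subseteq\Gamma$ and $E\subseteq\Delta$ there are a finite group $Q$, a group $K\in\mathcal{C}$, an action $Q\curvearrowright_\gamma K$ by automorphisms, and partial homomorphisms $\rho:F\to Q$, $\pi:E\to K$, with $\pi$ injective, such that for all $g\in F$, $h\in E$, if $\beta(g)[h]\in E$ then $\pi(\beta(g)[h])=\gamma(\rho(g))[\pi(h)]$. *)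

theory Defs
  imports "HOL-Algebra.Bij" "HOL-Algebra.Generated_Groups" "HOL-Algebra.Group_Action" "HOL-Library.Infinite_Typeclass"
begin

section \<open>Sets and graphs\<close>

text \<open>
  As in \<^const>\<open>Bij\<close> and \<^const>\<open>BijGroup\<close>, functions with a prescribed domain are taken to be
  extensional, so that a morphism is determined by its values on its domain; identities and
  composites are \<^term>\<open>\<lambda>x\<in>A. x\<close> and \<^const>\<open>compose\<close>.
\<close>

definition injections :: "'a set \<Rightarrow> 'b set \<Rightarrow> ('a \<Rightarrow> 'b) set" where
  "injections A B = {f \<in> A \<rightarrow>\<^sub>E B. inj_on f A}"

record 'v graph =
  verts :: "'v set"
  adj :: "('v \<times> 'v) set"

definition simple_graph :: "'v graph \<Rightarrow> bool" where
  "simple_graph X \<longleftrightarrow> adj X \<subseteq> verts X \<times> verts X \<and> sym (adj X) \<and> irrefl (adj X)"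

definition induced_subgraph :: "'v graph \<Rightarrow> 'v set \<Rightarrow> 'v graph" where
  "induced_subgraph X S = \<lparr>verts = S, adj = adj X \<inter> S \<times> S\<rparr>"

definition graph_inclusions :: "'a graph \<Rightarrow> 'b graph \<Rightarrow> ('a \<Rightarrow> 'b) set" where
  "graph_inclusions A B = {f \<in> injections (verts A) (verts B).
     \<forall>x\<in>verts A. \<forall>y\<in>verts A. (f x, f y) \<in> adj B \<longleftrightarrow> (x, y) \<in> adj A}"


section \<open>Haloes of groups\<close>

text \<open>
  The groups of the family are subgroups \<^term>\<open>H Y\<close> of the largest one, \<^term>\<open>G\<close>, which is the
  member of the family indexed by \<^term>\<open>X\<close> itself.
\<close>

definition halo_of_groups :: "'a set \<Rightarrow> 'h monoid \<Rightarrow> ('a set \<Rightarrow> 'h set) \<Rightarrow> bool" where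
  "halo_of_groups X G H \<longleftrightarrow>
     group G \<and> H X = carrier G \<and> (\<forall>Y. Y \<subseteq> X \<longrightarrow> subgroup (H Y) G) \<and>
     (\<forall>Y Z. Z \<subseteq> Y \<and> Y \<subseteq> X \<longrightarrow> subgroup (H Z) (G\<lparr>carrier := H Y\<rparr>)) \<and>
     H {} = {\<one>\<^bsub>G\<^esub>} \<and>
     carrier G = generate G (\<Union>Y\<in>{Y. Y \<subseteq> X \<and> finite Y}. H Y) \<and>
     (\<forall>Y Z. Y \<subseteq> X \<and> Z \<subseteq> X \<longrightarrow> H (Y \<inter> Z) = H Y \<inter> H Z)"

text \<open>
  Functors to groups and monomorphisms, from a category whose objects are the \<^term>\<open>A\<close> with
  \<^term>\<open>Obj A\<close>, whose morphisms from \<^term>\<open>A\<close> to \<^term>\<open>B\<close> are the functions in \<^term>\<open>Mor A B\<close>,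
  and in which the object \<^term>\<open>A\<close> has underlying set \<^term>\<open>und A\<close>. The functor sends \<^term>\<open>A\<close>
  to \<^term>\<open>L A\<close>, and a morphism \<^term>\<open>f\<close> from \<^term>\<open>A\<close> to \<^term>\<open>B\<close> to \<^term>\<open>hat A B f\<close>.
\<close>

definition functor_to_groups ::
  "('o \<Rightarrow> bool) \<Rightarrow> ('o \<Rightarrow> 'a set) \<Rightarrow> ('o \<Rightarrow> 'o \<Rightarrow> ('a \<Rightarrow> 'a) set) \<Rightarrow>
   ('o \<Rightarrow> 'h monoid) \<Rightarrow> ('o \<Rightarrow> 'o \<Rightarrow> ('a \<Rightarrow> 'a) \<Rightarrow> 'h \<Rightarrow> 'h) \<Rightarrow> bool" where
  "functor_to_groups Obj und Mor L hat \<longleftrightarrow>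
     (\<forall>A. Obj A \<longrightarrow> group (L A)) \<and>
     (\<forall>A B f. Obj A \<and> Obj B \<and> f \<in> Mor A B \<longrightarrow>
        hat A B f \<in> mon (L A) (L B) \<inter> extensional (carrier (L A))) \<and>
     (\<forall>A. Obj A \<longrightarrow> hat A A (\<lambda>x\<in>und A. x) = (\<lambda>h\<in>carrier (L A). h)) \<and>
     (\<forall>A B C f g. Obj A \<and> Obj B \<and> Obj C \<and> f \<in> Mor A B \<and> g \<in> Mor B C \<longrightarrow>
        hat A C (compose (und A) g f) = compose (carrier (L A)) (hat B C g) (hat A B f))"

text \<open>
  The category of sets is the category of subsets of an ambient type, which is
  required to be infinite so that, up to bijection, every finite set occurs;
  likewise for graphs.
\<close>

definition set_theoretic_halo ::
  "('u::infinite set \<Rightarrow> 'h monoid) \<Rightarrow> ('u set \<Rightarrow> 'u set \<Rightarrow> ('u \<Rightarrow> 'u) \<Rightarrow> 'h \<Rightarrow> 'h) \<Rightarrow> bool" where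
  "set_theoretic_halo L hat \<longleftrightarrow>
     functor_to_groups (\<lambda>_. True) (\<lambda>X. X) injections L hat \<and>
     (\<forall>X. halo_of_groups X (L X) (\<lambda>Y. hat Y X (\<lambda>x\<in>Y. x) ` carrier (L Y)))"

definition graph_theoretic_halo ::
  "('u::infinite graph \<Rightarrow> 'h monoid) \<Rightarrow> ('u graph \<Rightarrow> 'u graph \<Rightarrow> ('u \<Rightarrow> 'u) \<Rightarrow> 'h \<Rightarrow> 'h) \<Rightarrow> bool" where
  "graph_theoretic_halo L hat \<longleftrightarrow>
     functor_to_groups simple_graph verts graph_inclusions L hat \<and>
     (\<forall>X. simple_graph X \<longrightarrow> halo_of_groups (verts X) (L X)
        (\<lambda>Y. hat (induced_subgraph X Y) X (\<lambda>x\<in>Y. x) ` carrier (L (induced_subgraph X Y))))"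

definition induced_action ::
  "('o \<Rightarrow> 'o \<Rightarrow> ('a \<Rightarrow> 'a) \<Rightarrow> 'h \<Rightarrow> 'h) \<Rightarrow> 'o \<Rightarrow> ('g \<Rightarrow> 'a \<Rightarrow> 'a) \<Rightarrow> 'g \<Rightarrow> 'h \<Rightarrow> 'h" where
  "induced_action hat X \<alpha> = (\<lambda>g. hat X X (\<alpha> g))"


section \<open>LEF actions\<close>

definition graph_action :: "'g monoid \<Rightarrow> 'v graph \<Rightarrow> ('g \<Rightarrow> 'v \<Rightarrow> 'v) \<Rightarrow> bool" where
  "graph_action \<Gamma> X \<alpha> \<longleftrightarrow> simple_graph X \<and> group_action \<Gamma> (verts X) \<alpha> \<and>
     (\<forall>g\<in>carrier \<Gamma>. \<alpha> g \<in> graph_inclusions X X)"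

definition automorphism_action :: "'g monoid \<Rightarrow> 'h monoid \<Rightarrow> ('g \<Rightarrow> 'h \<Rightarrow> 'h) \<Rightarrow> bool" where
  "automorphism_action \<Gamma> \<Delta> \<beta> \<longleftrightarrow> group \<Gamma> \<and> group \<Delta> \<and> \<beta> \<in> hom \<Gamma> (AutoGroup \<Delta>)"

definition partial_hom :: "'g monoid \<Rightarrow> 'g set \<Rightarrow> 'k monoid \<Rightarrow> ('g \<Rightarrow> 'k) \<Rightarrow> bool" where
  "partial_hom G A K \<phi> \<longleftrightarrow> \<phi> \<in> A \<rightarrow> carrier K \<and>
     (\<forall>g\<in>A. \<forall>h\<in>A. g \<otimes>\<^bsub>G\<^esub> h \<in> A \<longrightarrow> \<phi> (g \<otimes>\<^bsub>G\<^esub> h) = \<phi> g \<otimes>\<^bsub>K\<^esub> \<phi> h)"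

text \<open>
  Up to isomorphism, every finite group, set or graph lives on a finite subset of
  \<^typ>\<open>nat\<close>, so there is no loss in letting the finite models below range over this type.
\<close>

definition set_LEF_action :: "'g monoid \<Rightarrow> 'a set \<Rightarrow> ('g \<Rightarrow> 'a \<Rightarrow> 'a) \<Rightarrow> bool" where
  "set_LEF_action \<Gamma> X \<alpha> \<longleftrightarrow> group_action \<Gamma> X \<alpha> \<and>
     (\<forall>F Z. finite F \<and> F \<subseteq> carrier \<Gamma> \<and> finite Z \<and> Z \<subseteq> X \<longrightarrow>
       (\<exists>(Q :: nat monoid) (Y :: nat set) \<beta> \<rho> \<pi>.
          finite (carrier Q) \<and> finite Y \<and> group_action Q Y \<beta> \<and>
          \<rho> \<in> carrier \<Gamma> \<rightarrow> carrier Q \<and> \<pi> \<in> injections Z Y \<and>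
          (\<forall>g\<in>F. \<forall>h\<in>F. g \<otimes>\<^bsub>\<Gamma>\<^esub> h \<in> F \<longrightarrow> \<rho> (g \<otimes>\<^bsub>\<Gamma>\<^esub> h) = \<rho> g \<otimes>\<^bsub>Q\<^esub> \<rho> h) \<and>
          (\<forall>g\<in>F. \<forall>x\<in>Z. \<alpha> g x \<in> Z \<longrightarrow> \<pi> (\<alpha> g x) = \<beta> (\<rho> g) (\<pi> x))))"

definition graph_LEF_action :: "'g monoid \<Rightarrow> 'a graph \<Rightarrow> ('g \<Rightarrow> 'a \<Rightarrow> 'a) \<Rightarrow> bool" where
  "graph_LEF_action \<Gamma> X \<alpha> \<longleftrightarrow> graph_action \<Gamma> X \<alpha> \<and>
     (\<forall>F Z. finite F \<and> F \<subseteq> carrier \<Gamma> \<and> finite Z \<and> Z \<subseteq> verts X \<longrightarrow>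
       (\<exists>(Q :: nat monoid) (Y :: nat graph) \<beta> \<rho> \<pi>.
          finite (carrier Q) \<and> finite (verts Y) \<and> graph_action Q Y \<beta> \<and>
          \<rho> \<in> carrier \<Gamma> \<rightarrow> carrier Q \<and> \<pi> \<in> graph_inclusions (induced_subgraph X Z) Y \<and>
          (\<forall>g\<in>F. \<forall>h\<in>F. g \<otimes>\<^bsub>\<Gamma>\<^esub> h \<in> F \<longrightarrow> \<rho> (g \<otimes>\<^bsub>\<Gamma>\<^esub> h) = \<rho> g \<otimes>\<^bsub>Q\<^esub> \<rho> h) \<and>
          (\<forall>g\<in>F. \<forall>x\<in>Z. \<alpha> g x \<in> Z \<longrightarrow> \<pi> (\<alpha> g x) = \<beta> (\<rho> g) (\<pi> x))))"

definition group_LEF_action ::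
  "'k monoid set \<Rightarrow> 'g monoid \<Rightarrow> 'h monoid \<Rightarrow> ('g \<Rightarrow> 'h \<Rightarrow> 'h) \<Rightarrow> bool" where
  "group_LEF_action \<C> \<Gamma> \<Delta> \<beta> \<longleftrightarrow> automorphism_action \<Gamma> \<Delta> \<beta> \<and>
     (\<forall>F E. finite F \<and> F \<subseteq> carrier \<Gamma> \<and> finite E \<and> E \<subseteq> carrier \<Delta> \<longrightarrow>
       (\<exists>(Q :: nat monoid) (K :: 'k monoid) \<gamma> \<rho> \<pi>.
          finite (carrier Q) \<and> K \<in> \<C> \<and> automorphism_action Q K \<gamma> \<and>
          partial_hom \<Gamma> F Q \<rho> \<and> partial_hom \<Delta> E K \<pi> \<and> inj_on \<pi> E \<and>
          (\<forall>g\<in>F. \<forall>h\<in>E. \<beta> g h \<in> E \<longrightarrow> \<pi> (\<beta> g h) = \<gamma> (\<rho> g) (\<pi> h))))"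

end

theory Submission
  imports Defs
begin

text \<open>
  A finite subset \<open>E\<close> of \<open>L(X)\<close> lies in \<open>L(Z)\<close> for some finite \<open>Z \<subseteq> X\<close>. A finite model \<open>(Q, Y, \<beta>, \<rho>, \<pi>)\<close>
  of the action for this \<open>Z\<close> gives the model \<open>L(Y)\<close> of the induced action, in which \<open>L(Z)\<close> is embedded
  by functoriality. If both \<open>h\<close> and \<open>gh\<close> lie in \<open>E\<close>, then \<open>h\<close> lies in \<open>L(W)\<close> for
  \<open>W = Z \<inter> g\<inverse>Z\<close>; on \<open>W\<close> the maps \<open>\<pi> \<circ> \<alpha>(g)\<close> and \<open>\<beta>(\<rho>(g)) \<circ> \<pi>\<close> agree, hence so do their
  images under the functor.
\<close>

section \<open>Haloes over a category of structured sets\<close>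

text \<open>Sets and simple graphs are treated at once. \<open>und A\<close> is the set of points of
  an object and \<open>sub A S\<close> the structure it induces on S. The assumptions after
  \<open>halo\<close> are the facts about the category that the argument uses;
  \<open>Mor_restrict\<close> allows the source and the target of a morphism to be cut down
  simultaneously.\<close>

locale halo_functor =
  fixes Obj :: "'o \<Rightarrow> bool"
    and und :: "'o \<Rightarrow> 'a set"
    and Mor :: "'o \<Rightarrow> 'o \<Rightarrow> ('a \<Rightarrow> 'a) set"
    and sub :: "'o \<Rightarrow> 'a set \<Rightarrow> 'o"
    and L :: "'o \<Rightarrow> 'h monoid"
    and hat :: "'o \<Rightarrow> 'o \<Rightarrow> ('a \<Rightarrow> 'a) \<Rightarrow> 'h \<Rightarrow> 'h"
  assumes is_functor: "functor_to_groups Obj und Mor L hat"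
    and halo: "Obj A \<Longrightarrow> halo_of_groups (und A) (L A)
      (\<lambda>S. hat (sub A S) A (\<lambda>x\<in>S. x) ` carrier (L (sub A S)))"
    and Obj_sub: "Obj A \<Longrightarrow> S \<subseteq> und A \<Longrightarrow> Obj (sub A S)"
    and und_sub: "und (sub A S) = S"
    and sub_und: "Obj A \<Longrightarrow> sub A (und A) = A"
    and Mor_id: "Obj A \<Longrightarrow> (\<lambda>x\<in>und A. x) \<in> Mor A A"
    and Mor_compose: "f \<in> Mor A B \<Longrightarrow> g \<in> Mor B C \<Longrightarrow> compose (und A) g f \<in> Mor A C"
    and Mor_restrict: "f \<in> Mor A B \<Longrightarrow> S \<subseteq> und A \<Longrightarrow> T \<subseteq> und B \<Longrightarrow> f ` S \<subseteq> T \<Longrightarrow>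
      restrict f S \<in> Mor (sub A S) (sub B T)"
begin

section \<open>Functoriality and naturality of inclusions\<close>

definition incl :: "'o \<Rightarrow> 'a set \<Rightarrow> 'h \<Rightarrow> 'h" where
  "incl A S = hat (sub A S) A (\<lambda>x\<in>S. x)"

text \<open>\<open>L (sub A S)\<close> is an abstract group of its own; this is its copy inside
  \<open>L A\<close>, the member of the halo indexed by S. Elements are moved between the two by
  \<open>incl A S\<close>, which is a monomorphism when S is a set of points of the object
  A.\<close>

definition part :: "'o \<Rightarrow> 'a set \<Rightarrow> 'h set" where
  "part A S = incl A S ` carrier (L (sub A S))"

lemma halo_part: "Obj A \<Longrightarrow> halo_of_groups (und A) (L A) (part A)"
  unfolding part_def[abs_def] incl_def[abs_def] by (rule halo)

lemma group_L: "Obj A \<Longrightarrow> group (L A)"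
  using is_functor by (simp add: functor_to_groups_def)

lemma hat_mon: "\<lbrakk>Obj A; Obj B; f \<in> Mor A B\<rbrakk> \<Longrightarrow> hat A B f \<in> mon (L A) (L B)"
  using is_functor by (simp add: functor_to_groups_def)

lemma hat_hom: "\<lbrakk>Obj A; Obj B; f \<in> Mor A B\<rbrakk> \<Longrightarrow> hat A B f \<in> hom (L A) (L B)"
  using hat_mon by (auto simp: mon_def)

lemma hat_inj: "\<lbrakk>Obj A; Obj B; f \<in> Mor A B\<rbrakk> \<Longrightarrow> inj_on (hat A B f) (carrier (L A))"
  using hat_mon by (auto simp: mon_def)

lemma hat_closed:
  "\<lbrakk>Obj A; Obj B; f \<in> Mor A B; h \<in> carrier (L A)\<rbrakk> \<Longrightarrow> hat A B f h \<in> carrier (L B)"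
  using hat_hom by (auto simp: hom_def)

lemma hat_extensional: "\<lbrakk>Obj A; Obj B; f \<in> Mor A B\<rbrakk> \<Longrightarrow> hat A B f \<in> extensional (carrier (L A))"
  using is_functor by (simp add: functor_to_groups_def)

lemma hat_id: "Obj A \<Longrightarrow> hat A A (\<lambda>x\<in>und A. x) = (\<lambda>h\<in>carrier (L A). h)"
  using is_functor by (simp add: functor_to_groups_def)

lemma hat_compose:
  "\<lbrakk>Obj A; Obj B; Obj C; f \<in> Mor A B; g \<in> Mor B C\<rbrakk> \<Longrightarrow>
    hat A C (compose (und A) g f) = compose (carrier (L A)) (hat B C g) (hat A B f)"
  using is_functor unfolding functor_to_groups_def by blast

lemma hat_compose_apply:
  "\<lbrakk>Obj A; Obj B; Obj C; f \<in> Mor A B; g \<in> Mor B C; h \<in> carrier (L A)\<rbrakk> \<Longrightarrow>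
    hat A C (compose (und A) g f) h = hat B C g (hat A B f h)"
  by (simp add: hat_compose compose_eq)

text \<open>The inclusion is the identity of A, cut down to S on the source and to T on the
  target.\<close>

lemma Mor_inclusion:
  assumes "Obj A" "S \<subseteq> T" "T \<subseteq> und A"
  shows "(\<lambda>x\<in>S. x) \<in> Mor (sub A S) (sub A T)"
proof -
  have "restrict (\<lambda>x\<in>und A. x) S \<in> Mor (sub A S) (sub A T)"
    using assms by (intro Mor_restrict Mor_id) auto
  moreover have "restrict (\<lambda>x\<in>und A. x) S = (\<lambda>x\<in>S. x)"
    using assms by (auto simp: fun_eq_iff)
  ultimately show ?thesis by simp
qed

lemma Mor_inclusion_und: "\<lbrakk>Obj A; S \<subseteq> und A\<rbrakk> \<Longrightarrow> (\<lambda>x\<in>S. x) \<in> Mor (sub A S) A"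
  using Mor_inclusion[of A S "und A"] by (simp add: sub_und)

text \<open>Naturality of the inclusions: including S in A and then applying f is the same map as
  restricting f to a map from S to T and then including T in B. The functor carries this square to
  groups.\<close>

lemma hat_incl:
  assumes A: "Obj A" and B: "Obj B" and f: "f \<in> Mor A B"
    and S: "S \<subseteq> und A" and T: "T \<subseteq> und B" and ST: "f ` S \<subseteq> T"
    and k: "k \<in> carrier (L (sub A S))"
  shows "hat A B f (incl A S k) = incl B T (hat (sub A S) (sub B T) (restrict f S) k)"
proof -
  have "compose S f (\<lambda>x\<in>S. x) = compose S (\<lambda>x\<in>T. x) (restrict f S)"
    using ST by (auto simp: compose_def fun_eq_iff)
  then show ?thesis
    using hat_compose_apply[OF Obj_sub[OF A S] A B Mor_inclusion_und[OF A S] f k]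
      hat_compose_apply[OF Obj_sub[OF A S] Obj_sub[OF B T] B Mor_restrict[OF f S T ST]
        Mor_inclusion_und[OF B T] k]
    by (simp add: und_sub incl_def)
qed

lemma hat_part:
  assumes "Obj A" "Obj B" "f \<in> Mor A B" "S \<subseteq> und A" "T \<subseteq> und B" "f ` S \<subseteq> T" "h \<in> part A S"
  shows "hat A B f h \<in> part B T"
proof -
  obtain k where k: "k \<in> carrier (L (sub A S))" "h = incl A S k"
    using assms(7) unfolding part_def by blast
  show ?thesis
    unfolding k(2) hat_incl[OF assms(1-6) k(1)] part_def
    using assms(1-6) k(1) by (intro imageI hat_closed Obj_sub Mor_restrict)
qed

section \<open>Finite supports\<close>

lemma part_subgroup: "\<lbrakk>Obj A; S \<subseteq> und A\<rbrakk> \<Longrightarrow> subgroup (part A S) (L A)"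
  using halo_part[of A] by (simp add: halo_of_groups_def)

lemma part_mono:
  assumes "Obj A" "S \<subseteq> T" "T \<subseteq> und A"
  shows "part A S \<subseteq> part A T"
proof -
  have "subgroup (part A S) (L A\<lparr>carrier := part A T\<rparr>)"
    using halo_part[of A] assms unfolding halo_of_groups_def by blast
  from subgroup.subset[OF this] show ?thesis by simp
qed

lemma part_Int:
  assumes "Obj A" "S \<subseteq> und A" "T \<subseteq> und A"
  shows "part A (S \<inter> T) = part A S \<inter> part A T"
  using halo_part[of A] assms unfolding halo_of_groups_def by blast

text \<open>The parts over finite sets generate \<open>L A\<close>, and they are directed: those
  over S1 and S2 both lie in the part over their union. A directed union of subgroups is closed
  under the group operations, so every generated element already lies in one finite part.\<close>

lemma in_finite_part:
  assumes A: "Obj A" and h: "h \<in> carrier (L A)"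
  shows "\<exists>S\<subseteq>und A. finite S \<and> h \<in> part A S"
proof -
  have "h \<in> generate (L A) (\<Union>S\<in>{S. S \<subseteq> und A \<and> finite S}. part A S)"
    using halo_part[OF A] h unfolding halo_of_groups_def by blast
  then show ?thesis
  proof (induction rule: generate.induct)
    case one
    have "\<one>\<^bsub>L A\<^esub> \<in> part A {}"
      using part_subgroup[OF A, of "{}"] by (simp add: subgroup.one_closed)
    then show ?case by blast
  next
    case (incl h)
    then show ?case by blast
  next
    case (inv h)
    then obtain S where S: "S \<subseteq> und A" "finite S" "h \<in> part A S" by blast
    then show ?case using subgroup.m_inv_closed[OF part_subgroup[OF A S(1)] S(3)] by blast
  next
    case (eng h1 h2)
    then obtain S1 S2 where S: "S1 \<subseteq> und A" "finite S1" "h1 \<in> part A S1"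
      "S2 \<subseteq> und A" "finite S2" "h2 \<in> part A S2" by blast
    then have "h1 \<in> part A (S1 \<union> S2)" "h2 \<in> part A (S1 \<union> S2)"
      using part_mono[OF A, of S1 "S1 \<union> S2"] part_mono[OF A, of S2 "S1 \<union> S2"] by blast+
    then have "h1 \<otimes>\<^bsub>L A\<^esub> h2 \<in> part A (S1 \<union> S2)"
      using subgroup.m_closed[OF part_subgroup[OF A, of "S1 \<union> S2"]] S by blast
    then show ?case using S(1,2,4,5) by (meson Un_least finite_UnI)
  qed
qed

lemma finite_subset_in_finite_part:
  assumes A: "Obj A" and "finite E" "E \<subseteq> carrier (L A)"
  shows "\<exists>S\<subseteq>und A. finite S \<and> E \<subseteq> part A S"
  using assms(2,3)
proof (induction rule: finite_induct)
  case empty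
  then show ?case by blast
next
  case (insert h E)
  then have h: "h \<in> carrier (L A)" and "\<exists>S\<subseteq>und A. finite S \<and> E \<subseteq> part A S" by auto
  then obtain S T where ST: "S \<subseteq> und A" "finite S" "E \<subseteq> part A S"
    "T \<subseteq> und A" "finite T" "h \<in> part A T"
    using in_finite_part[OF A h] by blast
  then have "insert h E \<subseteq> part A (S \<union> T)"
    using part_mono[OF A, of S "S \<union> T"] part_mono[OF A, of T "S \<union> T"] by blast
  then show ?case using ST(1,2,4,5) by (meson Un_least finite_UnI)
qed

section \<open>The induced action by automorphisms\<close>

lemma induced_action_compose:
  assumes A: "Obj A" and act: "group_action \<Gamma> (und A) \<alpha>"
    and mor: "\<And>g. g \<in> carrier \<Gamma> \<Longrightarrow> \<alpha> g \<in> Mor A A"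
    and g: "g \<in> carrier \<Gamma>" and h: "h \<in> carrier \<Gamma>"
  shows "induced_action hat A \<alpha> (g \<otimes>\<^bsub>\<Gamma>\<^esub> h) =
    compose (carrier (L A)) (induced_action hat A \<alpha> g) (induced_action hat A \<alpha> h)"
proof -
  interpret group_action \<Gamma> "und A" \<alpha> by fact
  \<comment> \<open>An action is a homomorphism into \<open>BijGroup\<close>, whose product of
    bijections is \<open>compose\<close>. The product of g and h therefore acts literally by a
    composite of morphisms, and the composition law of the functor applies.\<close>
  have "\<alpha> (g \<otimes>\<^bsub>\<Gamma>\<^esub> h) = compose (und A) (\<alpha> g) (\<alpha> h)"
    using group_hom group_hom.hom_mult[OF group_hom g h] bij_prop0[OF g] bij_prop0[OF h]
    by (simp add: BijGroup_def)
  then show ?thesis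
    using hat_compose[OF A A A mor[OF h] mor[OF g]] by (simp add: induced_action_def)
qed

text \<open>The neutral element acts on A by the extensional identity, which the functor sends to
  the identity of \<open>L A\<close>. Besides bijectivity of the induced maps, this yields a way to
  pull an image back to the original element.\<close>

lemma induced_action_inv:
  assumes A: "Obj A" and act: "group_action \<Gamma> (und A) \<alpha>"
    and mor: "\<And>g. g \<in> carrier \<Gamma> \<Longrightarrow> \<alpha> g \<in> Mor A A"
    and g: "g \<in> carrier \<Gamma>" and h: "h \<in> carrier (L A)"
  shows "induced_action hat A \<alpha> (inv\<^bsub>\<Gamma>\<^esub> g) (induced_action hat A \<alpha> g h) = h"
proof -
  interpret act: group_action \<Gamma> "und A" \<alpha> by fact
  interpret \<Gamma>: group \<Gamma> using act.group_hom by (simp add: group_hom_def)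
  have "induced_action hat A \<alpha> (inv\<^bsub>\<Gamma>\<^esub> g) (induced_action hat A \<alpha> g h) =
      induced_action hat A \<alpha> (inv\<^bsub>\<Gamma>\<^esub> g \<otimes>\<^bsub>\<Gamma>\<^esub> g) h"
    using induced_action_compose[OF A act mor, of "inv\<^bsub>\<Gamma>\<^esub> g" g] g h by (simp add: compose_eq)
  also have "\<dots> = h"
    using g h act.id_eq_one hat_id[OF A] by (simp add: induced_action_def)
  finally show ?thesis .
qed

text \<open>The functor by itself provides injective homomorphisms only. Surjectivity comes from the
  group: the map induced by the inverse of g is a two-sided inverse of the map induced by g.\<close>

lemma induced_automorphism_action:
  assumes A: "Obj A" and act: "group_action \<Gamma> (und A) \<alpha>"
    and mor: "\<And>g. g \<in> carrier \<Gamma> \<Longrightarrow> \<alpha> g \<in> Mor A A"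
  shows "automorphism_action \<Gamma> (L A) (induced_action hat A \<alpha>)"
proof -
  interpret act: group_action \<Gamma> "und A" \<alpha> by fact
  interpret \<Gamma>: group \<Gamma> using act.group_hom by (simp add: group_hom_def)
  let ?\<beta> = "induced_action hat A \<alpha>"
  have closed: "?\<beta> g h \<in> carrier (L A)" if "g \<in> carrier \<Gamma>" "h \<in> carrier (L A)" for g h
    using hat_closed[OF A A mor] that by (simp add: induced_action_def)
  have "bij_betw (?\<beta> g) (carrier (L A)) (carrier (L A))" if g: "g \<in> carrier \<Gamma>" for g
  proof (rule bij_betw_byWitness[where f' = "?\<beta> (inv\<^bsub>\<Gamma>\<^esub> g)"])
    show "\<forall>h\<in>carrier (L A). ?\<beta> (inv\<^bsub>\<Gamma>\<^esub> g) (?\<beta> g h) = h"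
      using induced_action_inv[OF A act mor g] by blast
    show "\<forall>h\<in>carrier (L A). ?\<beta> g (?\<beta> (inv\<^bsub>\<Gamma>\<^esub> g) h) = h"
      using induced_action_inv[OF A act mor, of "inv\<^bsub>\<Gamma>\<^esub> g"] g by simp
  qed (use closed g in auto)
  then have aut: "?\<beta> g \<in> auto (L A)" if "g \<in> carrier \<Gamma>" for g
    using hat_hom[OF A A mor] hat_extensional[OF A A mor] that
    by (simp add: auto_def Bij_def induced_action_def)
  have "?\<beta> \<in> hom \<Gamma> (AutoGroup (L A))"
  proof (rule homI)
    fix g assume "g \<in> carrier \<Gamma>"
    then show "?\<beta> g \<in> carrier (AutoGroup (L A))"
      using aut by (simp add: AutoGroup_def)
  next
    fix g h assume gh: "g \<in> carrier \<Gamma>" "h \<in> carrier \<Gamma>"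
    then have "?\<beta> g \<in> Bij (carrier (L A))" "?\<beta> h \<in> Bij (carrier (L A))"
      using aut by (auto simp: auto_def)
    then show "?\<beta> (g \<otimes>\<^bsub>\<Gamma>\<^esub> h) = ?\<beta> g \<otimes>\<^bsub>AutoGroup (L A)\<^esub> ?\<beta> h"
      using induced_action_compose[OF A act mor gh] by (simp add: AutoGroup_def BijGroup_def)
  qed
  then show ?thesis
    by (simp add: automorphism_action_def group_L[OF A] \<Gamma>.group_axioms)
qed

text \<open>The intersection axiom of a halo enters here: \<^term>\<open>h\<close> lies in the part over \<^term>\<open>Z\<close> and,
  pulling its image back, in the part over \<open>\<alpha>(g)\<inverse>Z\<close>.\<close>

lemma in_part_of_overlap:
  assumes A: "Obj A" and act: "group_action \<Gamma> (und A) \<alpha>"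
    and mor: "\<And>g. g \<in> carrier \<Gamma> \<Longrightarrow> \<alpha> g \<in> Mor A A"
    and g: "g \<in> carrier \<Gamma>" and Z: "Z \<subseteq> und A"
    and h: "h \<in> part A Z" and gh: "induced_action hat A \<alpha> g h \<in> part A Z"
  shows "h \<in> part A {x \<in> Z. \<alpha> g x \<in> Z}"
proof -
  interpret act: group_action \<Gamma> "und A" \<alpha> by fact
  interpret \<Gamma>: group \<Gamma> using act.group_hom by (simp add: group_hom_def)
  let ?T = "\<alpha> (inv\<^bsub>\<Gamma>\<^esub> g) ` Z"
  have ig: "inv\<^bsub>\<Gamma>\<^esub> g \<in> carrier \<Gamma>" using g by simp
  have T: "?T \<subseteq> und A" using act.surj_prop[OF ig] Z by blast
  have "h \<in> carrier (L A)" using subgroup.mem_carrier[OF part_subgroup[OF A Z] h] .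
  then have "h = hat A A (\<alpha> (inv\<^bsub>\<Gamma>\<^esub> g)) (induced_action hat A \<alpha> g h)"
    using induced_action_inv[OF A act mor g] by (simp add: induced_action_def)
  then have "h \<in> part A ?T"
    using hat_part[OF A A mor[OF ig] Z T subset_refl gh] by simp
  then have "h \<in> part A (Z \<inter> ?T)" using part_Int[OF A Z T] h by blast
  moreover have "Z \<inter> ?T = {x \<in> Z. \<alpha> g x \<in> Z}"
  proof -
    have "\<alpha> g (\<alpha> (inv\<^bsub>\<Gamma>\<^esub> g) x) = x" "\<alpha> (inv\<^bsub>\<Gamma>\<^esub> g) (\<alpha> g x) = x" if "x \<in> und A" for x
      using act.orbit_sym_aux[OF ig that refl] act.orbit_sym_aux[OF g that refl] g by simp_all
    with Z show ?thesis by (force simp: image_iff)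
  qed
  ultimately show ?thesis by simp
qed

text \<open>The common core of both cases. In the assumption \<open>LEF\<close> the model Y is an
  object of the category itself, so the functor can be evaluated on it: \<open>L Y\<close> is the
  group K, it lies in \<C> because Y is finite, and Q acts on it by the induced action.\<close>

lemma group_LEF_induced_action:
  fixes \<Gamma> :: "'g monoid"
  assumes X: "Obj X" and act: "group_action \<Gamma> (und X) \<alpha>"
    and mor: "\<And>g. g \<in> carrier \<Gamma> \<Longrightarrow> \<alpha> g \<in> Mor X X"
    and \<C>: "\<And>Y. \<lbrakk>Obj Y; finite (und Y)\<rbrakk> \<Longrightarrow> L Y \<in> \<C>"
    and LEF: "\<And>F Z. \<lbrakk>finite F; F \<subseteq> carrier \<Gamma>; finite Z; Z \<subseteq> und X\<rbrakk> \<Longrightarrow>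
      \<exists>(Q :: nat monoid) Y \<beta> \<rho> \<pi>.
        finite (carrier Q) \<and> Obj Y \<and> finite (und Y) \<and> group_action Q (und Y) \<beta> \<and>
        (\<forall>q\<in>carrier Q. \<beta> q \<in> Mor Y Y) \<and>
        \<rho> \<in> carrier \<Gamma> \<rightarrow> carrier Q \<and> \<pi> \<in> Mor (sub X Z) Y \<and>
        (\<forall>g\<in>F. \<forall>h\<in>F. g \<otimes>\<^bsub>\<Gamma>\<^esub> h \<in> F \<longrightarrow> \<rho> (g \<otimes>\<^bsub>\<Gamma>\<^esub> h) = \<rho> g \<otimes>\<^bsub>Q\<^esub> \<rho> h) \<and>
        (\<forall>g\<in>F. \<forall>x\<in>Z. \<alpha> g x \<in> Z \<longrightarrow> \<pi> (\<alpha> g x) = \<beta> (\<rho> g) (\<pi> x))"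
  shows "group_LEF_action \<C> \<Gamma> (L X) (induced_action hat X \<alpha>)"
  unfolding group_LEF_action_def
proof (intro conjI allI impI, rule induced_automorphism_action[OF X act mor])
  fix F E
  assume "finite F \<and> F \<subseteq> carrier \<Gamma> \<and> finite E \<and> E \<subseteq> carrier (L X)"
  then have F: "finite F" "F \<subseteq> carrier \<Gamma>" and E: "finite E" "E \<subseteq> carrier (L X)" by auto
  obtain Z where Z: "Z \<subseteq> und X" "finite Z" "E \<subseteq> part X Z"
    using finite_subset_in_finite_part[OF X E] by blast
  obtain Q :: "nat monoid" and Y \<beta> \<rho> \<pi> where
    Q: "finite (carrier Q)" and Y: "Obj Y" "finite (und Y)" and
    \<beta>: "group_action Q (und Y) \<beta>" "\<And>q. q \<in> carrier Q \<Longrightarrow> \<beta> q \<in> Mor Y Y" and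
    \<rho>: "\<rho> \<in> carrier \<Gamma> \<rightarrow> carrier Q" and \<pi>: "\<pi> \<in> Mor (sub X Z) Y" and
    \<rho>_mult: "\<forall>g\<in>F. \<forall>h\<in>F. g \<otimes>\<^bsub>\<Gamma>\<^esub> h \<in> F \<longrightarrow> \<rho> (g \<otimes>\<^bsub>\<Gamma>\<^esub> h) = \<rho> g \<otimes>\<^bsub>Q\<^esub> \<rho> h" and
    equiv: "\<And>g x. \<lbrakk>g \<in> F; x \<in> Z; \<alpha> g x \<in> Z\<rbrakk> \<Longrightarrow> \<pi> (\<alpha> g x) = \<beta> (\<rho> g) (\<pi> x)"
    using LEF[OF F Z(2,1)] by blast
  let ?LZ = "L (sub X Z)"
  let ?\<pi> = "hat (sub X Z) Y \<pi>"
  \<comment> \<open>The inclusion of the group over Z is undone and the monomorphism coming from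
    \<pi> is applied instead. Injectivity of \<open>incl X Z\<close> makes \<open>inv_into\<close>
    unambiguous on \<open>part X Z\<close>, and only the values there matter, since this part
    contains E.\<close>
  define \<Psi> where "\<Psi> = ?\<pi> \<circ> inv_into (carrier ?LZ) (incl X Z)"
  have ZX: "Obj (sub X Z)" and \<iota>: "(\<lambda>x\<in>Z. x) \<in> Mor (sub X Z) X"
    using Obj_sub[OF X Z(1)] Mor_inclusion_und[OF X Z(1)] by auto
  have \<Psi>_incl: "\<Psi> (incl X Z k) = ?\<pi> k" if "k \<in> carrier ?LZ" for k
    using inv_into_f_f[OF hat_inj[OF ZX X \<iota>] that] by (simp add: \<Psi>_def incl_def)
  have E_incl: "\<exists>k\<in>carrier ?LZ. h = incl X Z k" if "h \<in> E" for h
    using Z(3) that unfolding part_def by blast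
  have "partial_hom (L X) E (L Y) \<Psi>"
    unfolding partial_hom_def
  proof (intro conjI ballI impI funcsetI)
    fix h assume "h \<in> E"
    then show "\<Psi> h \<in> carrier (L Y)"
      using E_incl \<Psi>_incl hat_closed[OF ZX Y(1) \<pi>] by fastforce
  next
    fix h1 h2 assume "h1 \<in> E" "h2 \<in> E"
    then obtain k1 k2 where k: "k1 \<in> carrier ?LZ" "k2 \<in> carrier ?LZ"
      and h: "h1 = incl X Z k1" "h2 = incl X Z k2"
      using E_incl by meson
    \<comment> \<open>Products are formed in the group over Z: the product of the preimages k1 and
      k2 is a preimage of the product of h1 and h2, so multiplicativity of \<open>\<Psi>\<close>
      reduces to that of \<open>?\<pi>\<close>.\<close>
    have k12: "k1 \<otimes>\<^bsub>?LZ\<^esub> k2 \<in> carrier ?LZ"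
      using group_L[OF ZX] k by (simp add: group.is_monoid monoid.m_closed)
    have "h1 \<otimes>\<^bsub>L X\<^esub> h2 = incl X Z (k1 \<otimes>\<^bsub>?LZ\<^esub> k2)"
      using hom_mult[OF hat_hom[OF ZX X \<iota>] k] h by (simp add: incl_def)
    then show "\<Psi> (h1 \<otimes>\<^bsub>L X\<^esub> h2) = \<Psi> h1 \<otimes>\<^bsub>L Y\<^esub> \<Psi> h2"
      using \<Psi>_incl[OF k12] hom_mult[OF hat_hom[OF ZX Y(1) \<pi>] k] \<Psi>_incl k h by simp
  qed
  moreover have "inj_on \<Psi> E"
  proof (rule inj_onI)
    fix h1 h2 assume "h1 \<in> E" "h2 \<in> E" and eq: "\<Psi> h1 = \<Psi> h2"
    then obtain k1 k2 where k: "k1 \<in> carrier ?LZ" "k2 \<in> carrier ?LZ"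
      and h: "h1 = incl X Z k1" "h2 = incl X Z k2"
      using E_incl by meson
    then show "h1 = h2"
      using eq \<Psi>_incl inj_onD[OF hat_inj[OF ZX Y(1) \<pi>]] by metis
  qed
  moreover have "\<Psi> (induced_action hat X \<alpha> g h) = induced_action hat Y \<beta> (\<rho> g) (\<Psi> h)"
    if g: "g \<in> F" and h: "h \<in> E" and gh: "induced_action hat X \<alpha> g h \<in> E" for g h
  proof -
    have g\<Gamma>: "g \<in> carrier \<Gamma>" and \<beta>g: "\<beta> (\<rho> g) \<in> Mor Y Y"
      using g F(2) \<beta>(2) \<rho> by blast+
    \<comment> \<open>The points of Z that g keeps in Z. Equivariance of \<pi> is known exactly
      here, and the overlap lemma places h in the part over this set.\<close>
    let ?W = "{x \<in> Z. \<alpha> g x \<in> Z}"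
    have W: "?W \<subseteq> und X" "?W \<subseteq> Z" "\<alpha> g ` ?W \<subseteq> Z" using Z(1) by auto
    let ?\<alpha> = "restrict (\<alpha> g) ?W"
    obtain k where k: "k \<in> carrier (L (sub X ?W))" and hk: "h = incl X ?W k"
      using in_part_of_overlap[OF X act mor g\<Gamma> Z(1) subsetD[OF Z(3) h] subsetD[OF Z(3) gh]]
      unfolding part_def by blast
    have WX: "Obj (sub X ?W)" using Obj_sub[OF X W(1)] .
    have \<iota>W: "(\<lambda>x\<in>?W. x) \<in> Mor (sub X ?W) (sub X Z)" using Mor_inclusion[OF X W(2) Z(1)] .
    have \<alpha>W: "?\<alpha> \<in> Mor (sub X ?W) (sub X Z)" using Mor_restrict[OF mor[OF g\<Gamma>] W(1) Z(1) W(3)] .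
    \<comment> \<open>\<open>\<Psi>\<close> is computed from preimages over Z, whereas k lives over
      \<open>?W\<close>. Pushing k forward along the inclusion of \<open>?W\<close> in Z gives the
      preimage of h over Z.\<close>
    let ?m = "hat (sub X ?W) (sub X Z) (\<lambda>x\<in>?W. x) k"
    have m: "?m \<in> carrier ?LZ" using hat_closed[OF WX ZX \<iota>W k] .
    have "compose ?W (\<lambda>x\<in>Z. x) (\<lambda>x\<in>?W. x) = (\<lambda>x\<in>?W. x)"
      by (auto simp: compose_def fun_eq_iff)
    then have "h = incl X Z ?m"
      using hat_compose_apply[OF WX ZX X \<iota>W \<iota> k] hk by (simp add: und_sub incl_def)
    then have \<Psi>h: "\<Psi> h = ?\<pi> ?m" using \<Psi>_incl[OF m] by simp
    \<comment> \<open>Equivariance restated as an equality of morphisms from \<open>?W\<close> to Y,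
      so that the functor can be applied to both sides. The nested composite on the right has the
      shape needed to apply the composition law twice.\<close>
    have "compose ?W \<pi> ?\<alpha> = compose ?W (\<beta> (\<rho> g)) (compose ?W \<pi> (\<lambda>x\<in>?W. x))"
      using equiv[OF g] by (auto simp: compose_def fun_eq_iff)
    then have comm: "hat (sub X ?W) Y (compose ?W \<pi> ?\<alpha>) k =
        hat (sub X ?W) Y (compose ?W (\<beta> (\<rho> g)) (compose ?W \<pi> (\<lambda>x\<in>?W. x))) k"
      by simp
    \<comment> \<open>Naturality is used for \<alpha>(g) as a map from \<open>?W\<close> to Z; on
      all of Z it need not take values in Z.\<close>
    have "induced_action hat X \<alpha> g h = incl X Z (hat (sub X ?W) (sub X Z) ?\<alpha> k)"
      using hat_incl[OF X X mor[OF g\<Gamma>] W(1) Z(1) W(3) k] hk by (simp add: induced_action_def)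
    then have "\<Psi> (induced_action hat X \<alpha> g h) = ?\<pi> (hat (sub X ?W) (sub X Z) ?\<alpha> k)"
      using \<Psi>_incl[OF hat_closed[OF WX ZX \<alpha>W k]] by simp
    also have "\<dots> = hat (sub X ?W) Y (compose ?W \<pi> ?\<alpha>) k"
      using hat_compose_apply[OF WX ZX Y(1) \<alpha>W \<pi> k] by (simp add: und_sub)
    also have "\<dots> = hat Y Y (\<beta> (\<rho> g)) (?\<pi> ?m)"
      unfolding comm
      using hat_compose_apply[OF WX Y(1) Y(1) Mor_compose[OF \<iota>W \<pi>] \<beta>g k]
        hat_compose_apply[OF WX ZX Y(1) \<iota>W \<pi> k] by (simp add: und_sub)
    finally show ?thesis using \<Psi>h by (simp add: induced_action_def)
  qed
  moreover have "partial_hom \<Gamma> F Q \<rho>"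
    using \<rho> \<rho>_mult F(2) by (auto simp: partial_hom_def)
  moreover have "automorphism_action Q (L Y) (induced_action hat Y \<beta>)"
    using induced_automorphism_action[OF Y(1) \<beta>] .
  ultimately show "\<exists>(Q :: nat monoid) K \<gamma> \<rho> \<pi>. finite (carrier Q) \<and> K \<in> \<C> \<and>
      automorphism_action Q K \<gamma> \<and> partial_hom \<Gamma> F Q \<rho> \<and> partial_hom (L X) E K \<pi> \<and> inj_on \<pi> E \<and>
      (\<forall>g\<in>F. \<forall>h\<in>E. induced_action hat X \<alpha> g h \<in> E \<longrightarrow>
        \<pi> (induced_action hat X \<alpha> g h) = \<gamma> (\<rho> g) (\<pi> h))"
    using Q \<C>[OF Y] by blast
qed

end


section \<open>Sets and graphs\<close>

text \<open>The conjugate of f by the bijection j from Y onto its image, made extensional on that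
  image. It moves an action on a finite model over the natural numbers to the type on which the
  functor is defined.\<close>

definition transport :: "('a \<Rightarrow> 'b) \<Rightarrow> 'a set \<Rightarrow> ('a \<Rightarrow> 'a) \<Rightarrow> 'b \<Rightarrow> 'b" where
  "transport j Y f = (\<lambda>y\<in>j ` Y. j (f (inv_into Y j y)))"

lemma transport_apply: "\<lbrakk>inj_on j Y; x \<in> Y\<rbrakk> \<Longrightarrow> transport j Y f (j x) = j (f x)"
  by (simp add: transport_def)

lemma transport_Bij:
  assumes "inj_on j Y" "f \<in> Bij Y"
  shows "transport j Y f \<in> Bij (j ` Y)"
proof -
  have "bij_betw (j \<circ> f \<circ> inv_into Y j) (j ` Y) (j ` Y)"
    using assms by (auto simp: Bij_def intro!: bij_betw_trans bij_betw_inv_into inj_on_imp_bij_betw)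
  then have "bij_betw (transport j Y f) (j ` Y) (j ` Y)"
    by (rule bij_betw_cong[THEN iffD1, rotated]) (simp add: transport_def)
  then show ?thesis by (simp add: Bij_def transport_def)
qed

text \<open>Conjugation respects composition. This is checked at the points j x; off the image of Y
  both sides are \<open>undefined\<close>.\<close>

lemma group_action_transport:
  assumes j: "inj_on j Y" and act: "group_action G Y \<beta>"
  shows "group_action G (j ` Y) (\<lambda>g. transport j Y (\<beta> g))"
proof -
  interpret act: group_action G Y \<beta> by fact
  have G: "group G" using act.group_hom by (simp add: group_hom_def)
  have "(\<lambda>g. transport j Y (\<beta> g)) \<in> hom G (BijGroup (j ` Y))"
  proof (rule homI)
    fix g assume "g \<in> carrier G"
    then show "transport j Y (\<beta> g) \<in> carrier (BijGroup (j ` Y))"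
      using transport_Bij[OF j act.bij_prop0] by (simp add: BijGroup_def)
  next
    fix g h assume gh: "g \<in> carrier G" "h \<in> carrier G"
    have "transport j Y (\<beta> (g \<otimes>\<^bsub>G\<^esub> h)) =
        compose (j ` Y) (transport j Y (\<beta> g)) (transport j Y (\<beta> h))"
    proof
      fix y
      show "transport j Y (\<beta> (g \<otimes>\<^bsub>G\<^esub> h)) y =
        compose (j ` Y) (transport j Y (\<beta> g)) (transport j Y (\<beta> h)) y"
      proof (cases "y \<in> j ` Y")
        case True
        then obtain x where "x \<in> Y" "y = j x" by blast
        then show ?thesis
          using act.composition_rule[of x g h] act.element_image[OF gh(2)] gh
          by (simp add: compose_eq transport_apply[OF j])
      qed (simp add: transport_def compose_def)
    qed
    then show "transport j Y (\<beta> (g \<otimes>\<^bsub>G\<^esub> h)) =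
        transport j Y (\<beta> g) \<otimes>\<^bsub>BijGroup (j ` Y)\<^esub> transport j Y (\<beta> h)"
      using transport_Bij[OF j act.bij_prop0] gh by (simp add: BijGroup_def)
  qed
  then show ?thesis
    by (simp add: group_action_def group_hom_def group_hom_axioms_def G group_BijGroup)
qed

section \<open>The case of sets\<close>

lemma compose_injections:
  "\<lbrakk>f \<in> injections A B; g \<in> injections B C\<rbrakk> \<Longrightarrow> compose A g f \<in> injections A C"
  by (auto simp: injections_def compose_def inj_on_def PiE_iff)

lemma Bij_injections: "f \<in> Bij A \<Longrightarrow> f \<in> injections A A"
  by (auto simp: Bij_def injections_def bij_betw_def PiE_iff)

lemma inj_on_injections: "inj_on j A \<Longrightarrow> restrict j A \<in> injections A (j ` A)"
  by (auto simp: injections_def inj_on_def)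

lemma set_halo_functor:
  assumes "set_theoretic_halo L hat"
  shows "halo_functor (\<lambda>_. True) (\<lambda>X. X) injections (\<lambda>_ S. S) L hat"
proof
  show "compose A g f \<in> injections A C"
    if "f \<in> injections A B" "g \<in> injections B C" for A B C :: "'a set" and f g
    using that by (rule compose_injections)
qed (use assms in \<open>auto simp: set_theoretic_halo_def injections_def inj_on_def subset_iff\<close>)

text \<open>The models of a LEF action live on the natural numbers, but L takes subsets of the
  infinite type \<open>'u\<close>. An injection j between these types replaces a model by an
  isomorphic one in the domain of L: Q and \<rho> are kept, \<beta> is conjugated by j, and \<pi> is
  followed by j.\<close>

lemma set_LEF_induced_action:
  fixes L :: "'u::infinite set \<Rightarrow> 'h monoid"
  assumes halo: "set_theoretic_halo L hat" and \<C>: "\<And>Y. finite Y \<Longrightarrow> L Y \<in> \<C>"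
    and LEF: "set_LEF_action \<Gamma> X \<alpha>"
  shows "group_LEF_action \<C> \<Gamma> (L X) (induced_action hat X \<alpha>)"
proof -
  interpret halo_functor "\<lambda>_. True" "\<lambda>X. X" injections "\<lambda>_ S. S" L hat
    using set_halo_functor[OF halo] .
  have act: "group_action \<Gamma> X \<alpha>" using LEF by (simp add: set_LEF_action_def)
  obtain j :: "nat \<Rightarrow> 'u" where "inj j"
    using infinite_UNIV infinite_countable_subset by blast
  then have j: "inj_on j Y" for Y using inj_on_subset by blast
  show ?thesis
  proof (rule group_LEF_induced_action[OF _ act])
    show "\<alpha> g \<in> injections X X" if "g \<in> carrier \<Gamma>" for g
      using Bij_injections group_action.bij_prop0[OF act that] by blast
  next
    fix F Z
    assume FZ: "finite F" "F \<subseteq> carrier \<Gamma>" "finite Z" "Z \<subseteq> X"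
    then obtain Q :: "nat monoid" and Y :: "nat set" and \<beta> \<rho> \<pi> where
      Q: "finite (carrier Q)" and Y: "finite Y" and \<beta>: "group_action Q Y \<beta>" and
      \<rho>: "\<rho> \<in> carrier \<Gamma> \<rightarrow> carrier Q" and \<pi>: "\<pi> \<in> injections Z Y" and
      mult: "\<forall>g\<in>F. \<forall>h\<in>F. g \<otimes>\<^bsub>\<Gamma>\<^esub> h \<in> F \<longrightarrow> \<rho> (g \<otimes>\<^bsub>\<Gamma>\<^esub> h) = \<rho> g \<otimes>\<^bsub>Q\<^esub> \<rho> h" and
      equiv: "\<forall>g\<in>F. \<forall>x\<in>Z. \<alpha> g x \<in> Z \<longrightarrow> \<pi> (\<alpha> g x) = \<beta> (\<rho> g) (\<pi> x)"
      using LEF[unfolded set_LEF_action_def, THEN conjunct2, THEN spec[of _ F], THEN spec[of _ Z]]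
      by (elim impE exE conjE) (blast, rule that)
    let ?\<beta> = "\<lambda>q. transport j Y (\<beta> q)"
    let ?\<pi> = "compose Z (restrict j Y) \<pi>"
    note act' = group_action_transport[OF j \<beta>]
    have "?\<pi> \<in> injections Z (j ` Y)"
      using compose_injections[OF \<pi> inj_on_injections[OF j]] .
    moreover have "?\<beta> q \<in> injections (j ` Y) (j ` Y)" if "q \<in> carrier Q" for q
      using Bij_injections group_action.bij_prop0[OF act' that] by blast
    moreover have "?\<pi> (\<alpha> g x) = ?\<beta> (\<rho> g) (?\<pi> x)" if "g \<in> F" "x \<in> Z" "\<alpha> g x \<in> Z" for g x
    proof -
      have "\<pi> x \<in> Y" "\<pi> (\<alpha> g x) \<in> Y" using \<pi> that by (auto simp: injections_def)
      then show ?thesis using equiv that by (simp add: compose_eq transport_apply[OF j])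
    qed
    ultimately show "\<exists>(Q :: nat monoid) (Y :: 'u set) \<beta> \<rho> \<pi>.
        finite (carrier Q) \<and> True \<and> finite Y \<and> group_action Q Y \<beta> \<and>
        (\<forall>q\<in>carrier Q. \<beta> q \<in> injections Y Y) \<and>
        \<rho> \<in> carrier \<Gamma> \<rightarrow> carrier Q \<and> \<pi> \<in> injections Z Y \<and>
        (\<forall>g\<in>F. \<forall>h\<in>F. g \<otimes>\<^bsub>\<Gamma>\<^esub> h \<in> F \<longrightarrow> \<rho> (g \<otimes>\<^bsub>\<Gamma>\<^esub> h) = \<rho> g \<otimes>\<^bsub>Q\<^esub> \<rho> h) \<and>
        (\<forall>g\<in>F. \<forall>x\<in>Z. \<alpha> g x \<in> Z \<longrightarrow> \<pi> (\<alpha> g x) = \<beta> (\<rho> g) (\<pi> x))"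
      using Q Y act' \<rho> mult
      by (intro exI[of _ Q] exI[of _ "j ` Y"] exI[of _ ?\<beta>] exI[of _ \<rho>] exI[of _ ?\<pi>]) auto
  qed (use \<C> in auto)
qed

section \<open>The case of graphs\<close>

lemma compose_graph_inclusions:
  assumes f: "f \<in> graph_inclusions A B" and g: "g \<in> graph_inclusions B C"
  shows "compose (verts A) g f \<in> graph_inclusions A C"
proof -
  have "f x \<in> verts B" if "x \<in> verts A" for x
    using f that by (auto simp: graph_inclusions_def injections_def)
  with f g show ?thesis by (auto simp: graph_inclusions_def compose_eq intro: compose_injections)
qed

text \<open>An induced subgraph keeps every edge between its vertices, so the equivalence between
  adjacency in the source and in the target survives restriction on both sides.\<close>

lemma restrict_graph_inclusions:
  assumes "f \<in> graph_inclusions A B" "S \<subseteq> verts A" "f ` S \<subseteq> T"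
  shows "restrict f S \<in> graph_inclusions (induced_subgraph A S) (induced_subgraph B T)"
proof -
  have "inj_on f S" using assms by (auto simp: graph_inclusions_def injections_def intro: inj_on_subset)
  with assms show ?thesis
    by (auto simp: graph_inclusions_def injections_def induced_subgraph_def inj_on_restrict_eq
      subset_iff image_subset_iff)
qed

text \<open>For injective j this is an isomorphic copy of Y: the edges are exactly the images of
  edges, so adjacency is both preserved and reflected.\<close>

definition image_graph :: "('a \<Rightarrow> 'b) \<Rightarrow> 'a graph \<Rightarrow> 'b graph" where
  "image_graph j Y = \<lparr>verts = j ` verts Y, adj = map_prod j j ` adj Y\<rparr>"

lemma simple_image_graph: "\<lbrakk>inj j; simple_graph Y\<rbrakk> \<Longrightarrow> simple_graph (image_graph j Y)"
  by (fastforce simp: simple_graph_def image_graph_def sym_def irrefl_def inj_eq)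

lemma adj_image_graph: "inj j \<Longrightarrow> (j x, j y) \<in> adj (image_graph j Y) \<longleftrightarrow> (x, y) \<in> adj Y"
  by (auto simp: image_graph_def inj_eq)

lemma verts_image_graph: "verts (image_graph j Y) = j ` verts Y"
  by (simp add: image_graph_def)

lemma restrict_inj_graph_inclusions:
  "inj j \<Longrightarrow> restrict j (verts Y) \<in> graph_inclusions Y (image_graph j Y)"
  using inj_on_injections[of j "verts Y"]
  by (simp add: graph_inclusions_def adj_image_graph verts_image_graph inj_on_subset[OF _ subset_UNIV])

text \<open>Since j preserves and reflects adjacency, conjugating an automorphism of Y by j gives an
  automorphism of the copy.\<close>

lemma graph_action_image:
  assumes j: "inj j" and act: "graph_action G Y \<beta>"
  shows "graph_action G (image_graph j Y) (\<lambda>g. transport j (verts Y) (\<beta> g))"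
proof -
  have jY: "inj_on j (verts Y)" using j using inj_on_subset by blast
  have Y: "simple_graph Y" and \<beta>: "group_action G (verts Y) \<beta>"
    and aut: "\<And>g. g \<in> carrier G \<Longrightarrow> \<beta> g \<in> graph_inclusions Y Y"
    using act by (auto simp: graph_action_def)
  note act' = group_action_transport[OF jY \<beta>]
  have "transport j (verts Y) (\<beta> g) \<in> graph_inclusions (image_graph j Y) (image_graph j Y)"
    if g: "g \<in> carrier G" for g
    using aut[OF g] Bij_injections[OF group_action.bij_prop0[OF act' g]]
    by (auto simp: graph_inclusions_def verts_image_graph adj_image_graph[OF j] transport_apply[OF jY])
  then show ?thesis
    using act' simple_image_graph[OF j Y] by (simp add: graph_action_def verts_image_graph)
qed

lemma graph_halo_functor:
  assumes "graph_theoretic_halo L hat"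
  shows "halo_functor simple_graph verts graph_inclusions induced_subgraph L hat"
proof
  \<comment> \<open>Simplicity enters through the requirement that edges join vertices of the graph;
    otherwise inducing on all vertices could discard some pairs.\<close>
  show "induced_subgraph A (verts A) = A" if "simple_graph A" for A :: "'a graph"
    using that by (cases A) (auto simp: simple_graph_def induced_subgraph_def)
  show "compose (verts A) g f \<in> graph_inclusions A C"
    if "f \<in> graph_inclusions A B" "g \<in> graph_inclusions B C" for A B C :: "'a graph" and f g
    using that by (rule compose_graph_inclusions)
  show "restrict f S \<in> graph_inclusions (induced_subgraph A S) (induced_subgraph B T)"
    if "f \<in> graph_inclusions A B" "S \<subseteq> verts A" "f ` S \<subseteq> T" for A B :: "'a graph" and f S T
    using that by (rule restrict_graph_inclusions)
  show "simple_graph (induced_subgraph A S)" if "simple_graph A" for A :: "'a graph" and S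
    using that by (auto simp: simple_graph_def induced_subgraph_def sym_def irrefl_def)
qed (use assms in \<open>auto simp: graph_theoretic_halo_def graph_inclusions_def injections_def
  induced_subgraph_def inj_on_def\<close>)

text \<open>As for sets, the finite model is carried into the ambient type along an injection of the
  natural numbers. Here the copy must also keep its edges, hence the use of
  \<open>image_graph\<close>.\<close>

lemma graph_LEF_induced_action:
  fixes L :: "'v::infinite graph \<Rightarrow> 'h monoid"
  assumes halo: "graph_theoretic_halo L hat"
    and \<C>: "\<And>Y. \<lbrakk>simple_graph Y; finite (verts Y)\<rbrakk> \<Longrightarrow> L Y \<in> \<C>"
    and LEF: "graph_LEF_action \<Gamma> X \<alpha>"
  shows "group_LEF_action \<C> \<Gamma> (L X) (induced_action hat X \<alpha>)"
proof -
  interpret halo_functor simple_graph verts graph_inclusions induced_subgraph L hat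
    using graph_halo_functor[OF halo] .
  have X: "simple_graph X" and act: "group_action \<Gamma> (verts X) \<alpha>"
    and mor: "\<And>g. g \<in> carrier \<Gamma> \<Longrightarrow> \<alpha> g \<in> graph_inclusions X X"
    using LEF by (auto simp: graph_LEF_action_def graph_action_def)
  obtain j :: "nat \<Rightarrow> 'v" where j: "inj j"
    using infinite_UNIV infinite_countable_subset by blast
  show ?thesis
  proof (rule group_LEF_induced_action[OF X act mor \<C>])
    fix F Z
    assume FZ: "finite F" "F \<subseteq> carrier \<Gamma>" "finite Z" "Z \<subseteq> verts X"
    then obtain Q :: "nat monoid" and Y :: "nat graph" and \<beta> \<rho> \<pi> where
      Q: "finite (carrier Q)" and Y: "finite (verts Y)" and \<beta>: "graph_action Q Y \<beta>" and
      \<rho>: "\<rho> \<in> carrier \<Gamma> \<rightarrow> carrier Q" and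
      \<pi>: "\<pi> \<in> graph_inclusions (induced_subgraph X Z) Y" and
      mult: "\<forall>g\<in>F. \<forall>h\<in>F. g \<otimes>\<^bsub>\<Gamma>\<^esub> h \<in> F \<longrightarrow> \<rho> (g \<otimes>\<^bsub>\<Gamma>\<^esub> h) = \<rho> g \<otimes>\<^bsub>Q\<^esub> \<rho> h" and
      equiv: "\<forall>g\<in>F. \<forall>x\<in>Z. \<alpha> g x \<in> Z \<longrightarrow> \<pi> (\<alpha> g x) = \<beta> (\<rho> g) (\<pi> x)"
      using LEF[unfolded graph_LEF_action_def, THEN conjunct2, THEN spec[of _ F], THEN spec[of _ Z]]
      by (elim impE exE conjE) (blast, rule that)
    let ?\<beta> = "\<lambda>q. transport j (verts Y) (\<beta> q)"
    let ?\<pi> = "compose Z (restrict j (verts Y)) \<pi>"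
    note act' = graph_action_image[OF j \<beta>]
    have jY: "inj_on j (verts Y)" using j using inj_on_subset by blast
    have "?\<pi> \<in> graph_inclusions (induced_subgraph X Z) (image_graph j Y)"
      using compose_graph_inclusions[OF \<pi> restrict_inj_graph_inclusions[OF j]]
      by (simp add: und_sub)
    moreover have "?\<pi> (\<alpha> g x) = ?\<beta> (\<rho> g) (?\<pi> x)" if "g \<in> F" "x \<in> Z" "\<alpha> g x \<in> Z" for g x
    proof -
      have "\<pi> x \<in> verts Y" "\<pi> (\<alpha> g x) \<in> verts Y"
        using \<pi> that
        by (auto simp: graph_inclusions_def injections_def induced_subgraph_def)
      then show ?thesis using equiv that by (simp add: compose_eq transport_apply[OF jY])
    qed
    moreover have "finite (verts (image_graph j Y))" using Y by (simp add: verts_image_graph)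
    ultimately show "\<exists>(Q :: nat monoid) (Y :: 'v graph) \<beta> \<rho> \<pi>.
        finite (carrier Q) \<and> simple_graph Y \<and> finite (verts Y) \<and> group_action Q (verts Y) \<beta> \<and>
        (\<forall>q\<in>carrier Q. \<beta> q \<in> graph_inclusions Y Y) \<and>
        \<rho> \<in> carrier \<Gamma> \<rightarrow> carrier Q \<and> \<pi> \<in> graph_inclusions (induced_subgraph X Z) Y \<and>
        (\<forall>g\<in>F. \<forall>h\<in>F. g \<otimes>\<^bsub>\<Gamma>\<^esub> h \<in> F \<longrightarrow> \<rho> (g \<otimes>\<^bsub>\<Gamma>\<^esub> h) = \<rho> g \<otimes>\<^bsub>Q\<^esub> \<rho> h) \<and>
        (\<forall>g\<in>F. \<forall>x\<in>Z. \<alpha> g x \<in> Z \<longrightarrow> \<pi> (\<alpha> g x) = \<beta> (\<rho> g) (\<pi> x))"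
      using Q act' \<rho> mult unfolding graph_action_def
      by (intro exI[of _ Q] exI[of _ "image_graph j Y"] exI[of _ ?\<beta>] exI[of _ \<rho>] exI[of _ ?\<pi>]) auto
  qed
qed

theorem proposition1p6:
  fixes \<C> :: "'h monoid set"
    and \<Gamma> :: "'g monoid"
    and L\<^sub>s :: "'u::infinite set \<Rightarrow> 'h monoid"
    and hat\<^sub>s :: "'u set \<Rightarrow> 'u set \<Rightarrow> ('u \<Rightarrow> 'u) \<Rightarrow> 'h \<Rightarrow> 'h"
    and X\<^sub>s :: "'u set"
    and \<alpha>\<^sub>s :: "'g \<Rightarrow> 'u \<Rightarrow> 'u"
    and L\<^sub>g :: "'v::infinite graph \<Rightarrow> 'h monoid"
    and hat\<^sub>g :: "'v graph \<Rightarrow> 'v graph \<Rightarrow> ('v \<Rightarrow> 'v) \<Rightarrow> 'h \<Rightarrow> 'h"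
    and X\<^sub>g :: "'v graph"
    and \<alpha>\<^sub>g :: "'g \<Rightarrow> 'v \<Rightarrow> 'v"
  assumes "\<And>K. K \<in> \<C> \<Longrightarrow> group K"
  shows "(set_theoretic_halo L\<^sub>s hat\<^sub>s \<and>
          (\<forall>Y. finite Y \<longrightarrow> L\<^sub>s Y \<in> \<C>) \<and>
          set_LEF_action \<Gamma> X\<^sub>s \<alpha>\<^sub>s \<longrightarrow>
            group_LEF_action \<C> \<Gamma> (L\<^sub>s X\<^sub>s) (induced_action hat\<^sub>s X\<^sub>s \<alpha>\<^sub>s)) \<and>
         (graph_theoretic_halo L\<^sub>g hat\<^sub>g \<and>
          (\<forall>Y. simple_graph Y \<and> finite (verts Y) \<longrightarrow> L\<^sub>g Y \<in> \<C>) \<and>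
          graph_LEF_action \<Gamma> X\<^sub>g \<alpha>\<^sub>g \<longrightarrow>
            group_LEF_action \<C> \<Gamma> (L\<^sub>g X\<^sub>g) (induced_action hat\<^sub>g X\<^sub>g \<alpha>\<^sub>g))"
  using set_LEF_induced_action[of L\<^sub>s hat\<^sub>s \<C> \<Gamma> X\<^sub>s \<alpha>\<^sub>s] graph_LEF_induced_action[of L\<^sub>g hat\<^sub>g \<C> \<Gamma> X\<^sub>g \<alpha>\<^sub>g] by blast

end
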